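(* Let $I=\{1,\dots,n\}$, let $A$ be a finite set, and let $G$ be a strategic game with player set $I$, common action set $A$ and payoff functions $\pi_i:A^I\to\mathbb{R}$ ($i\in I$). Then $G$ is symmetric if and only if $i\,\mathbf{B}\,j$ holds for all players $i,j\in I$.
   Context: For a profile $\mathbf{a}\in A^I$ and a permutation $\sigma$ of $I$, $\mathbf{a}\sigma=(a_{\sigma(1)},\dots,a_{\sigma(n)})$. $\mathbf{a}_{-i}$ is $\mathbf{a}$ with the $i$-th coordinate deleted; for a vector $\mathbf{x}$ with entries in $A$, $\#\mathbf{x}=(\#(a,\mathbf{x}))_{a\in A}$, where $\#(a,\mathbf{x})$ is the number of coordinates of $\mathbf{x}$ equal to $a$. Symmetric: for all $i,j\in I$ and all $\mathbf{a},\mathbf{b}\in A^I$, if $a_i=b_j$ and $\#\mathbf{a}_{-i}=\#\mathbf{b}_{-j}$, then $\pi_i(\mathbf{a})=\pi_j(\mathbf{b})$. Blindly related players: $i\,\mathbf{B}\,j$ means that for every permutation $\sigma$ of $I$ with $\sigma(i)=j$ and $\sigma(j)=i$ and every $\mathbf{a}\in A^I$, $\pi_i(\mathbf{a})=\pi_j(\mathbf{a}\sigma)$ (with $i=j$ allowed). *)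

theory Defs
  imports Complex_Main "HOL-Library.FuncSet" "HOL-Combinatorics.Permutations"
begin

text \<open>
  A strategic game with player set \<open>I\<close> and common action set \<open>A\<close> is given by its payoff functions
  \<open>\<pi> :: 'i \<Rightarrow> ('i \<Rightarrow> 'a) \<Rightarrow> real\<close>.  A vector with coordinates indexed by \<open>J\<close> and entries in \<open>A\<close> is an
  element of \<open>J \<rightarrow>\<^sub>E A\<close>, that is, a function with value \<open>undefined\<close> outside \<open>J\<close>; only the
  values \<open>\<pi> i a\<close> for \<open>i \<in> I\<close> and \<open>a \<in> I \<rightarrow>\<^sub>E A\<close> matter.
\<close>

definition permute_profile :: "'i set \<Rightarrow> ('i \<Rightarrow> 'a) \<Rightarrow> ('i \<Rightarrow> 'i) \<Rightarrow> ('i \<Rightarrow> 'a)" where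
  "permute_profile I a \<sigma> = (\<lambda>k\<in>I. a (\<sigma> k))"

text \<open>The vector \<open>a\<^sub>-\<^sub>i\<close>, whose coordinates keep their labels and are indexed by \<open>I - {i}\<close>.\<close>

definition delete_coord :: "'i set \<Rightarrow> 'i \<Rightarrow> ('i \<Rightarrow> 'a) \<Rightarrow> ('i \<Rightarrow> 'a)" where
  "delete_coord I i a = restrict a (I - {i})"

text \<open>\<open>#x = (#(c, x))\<close> for \<open>c \<in> A\<close>, where \<open>x\<close> is a vector with index set \<open>J\<close>.\<close>

definition coord_count :: "'i set \<Rightarrow> 'a \<Rightarrow> ('i \<Rightarrow> 'a) \<Rightarrow> nat" where
  "coord_count J c x = card {k \<in> J. x k = c}"

definition count_vector :: "'a set \<Rightarrow> 'i set \<Rightarrow> ('i \<Rightarrow> 'a) \<Rightarrow> ('a \<Rightarrow> nat)" where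
  "count_vector A J x = (\<lambda>c\<in>A. coord_count J c x)"

definition symmetric_game :: "'i set \<Rightarrow> 'a set \<Rightarrow> ('i \<Rightarrow> ('i \<Rightarrow> 'a) \<Rightarrow> real) \<Rightarrow> bool" where
  "symmetric_game I A \<pi> \<longleftrightarrow>
    (\<forall>i\<in>I. \<forall>j\<in>I. \<forall>a \<in> I \<rightarrow>\<^sub>E A. \<forall>b \<in> I \<rightarrow>\<^sub>E A.
      a i = b j \<and>
      count_vector A (I - {i}) (delete_coord I i a) = count_vector A (I - {j}) (delete_coord I j b)
      \<longrightarrow> \<pi> i a = \<pi> j b)"

definition blindly_related ::
  "'i set \<Rightarrow> 'a set \<Rightarrow> ('i \<Rightarrow> ('i \<Rightarrow> 'a) \<Rightarrow> real) \<Rightarrow> 'i \<Rightarrow> 'i \<Rightarrow> bool" where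
  "blindly_related I A \<pi> i j \<longleftrightarrow>
    (\<forall>\<sigma>. \<sigma> permutes I \<and> \<sigma> i = j \<and> \<sigma> j = i \<longrightarrow>
      (\<forall>a \<in> I \<rightarrow>\<^sub>E A. \<pi> i a = \<pi> j (permute_profile I a \<sigma>)))"

end

theory Submission
  imports Defs
begin

text \<open>
  In a symmetric game every payoff is one and the same function of the own action and of how often
  each action is played by the others; blind relatedness of two players says that payoffs do not
  change under relabellings of the players that swap these two.  The conditions agree because two
  finite vectors have the same action counts exactly when they differ by a permutation of their
  coordinates.

  If \<open>\<sigma>\<close> permutes the players and sends \<open>j\<close> to \<open>i\<close>, then \<open>j\<close> faces in \<open>a\<sigma>\<close> the same counts and plays
  the same action as \<open>i\<close> in \<open>a\<close> (lemma \<open>count_vector_delete_permute_profile\<close>), so symmetry gives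
  blind relatedness.

  Conversely, let \<open>a\<close> seen by \<open>i\<close> and \<open>b\<close> seen by \<open>j\<close> agree up to counts.  Transposing \<open>i\<close> and \<open>j\<close>
  turns \<open>a\<close> into a profile \<open>c\<close> with \<open>\<pi> i a = \<pi> j c\<close>, and \<open>c\<close> and \<open>b\<close> now differ only by a rearrangement of
  the opponents of the one player \<open>j\<close>.  Equality of counts provides this rearrangement
  (lemma \<open>permutation_of_equal_counts\<close>); it fixes \<open>j\<close>, so \<open>j\<close> being blindly related to itself yields
  \<open>\<pi> j c = \<pi> j b\<close>.
\<close>

lemma coord_count_delete_coord:
  "coord_count (I - {i}) c (delete_coord I i a) = coord_count (I - {i}) c a"
  unfolding coord_count_def delete_coord_def by (rule arg_cong[where f = card]) auto

lemma permute_profile_in_profiles: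
  assumes "\<sigma> permutes I" and "a \<in> I \<rightarrow>\<^sub>E A"
  shows "permute_profile I a \<sigma> \<in> I \<rightarrow>\<^sub>E A"
proof -
  have "a (\<sigma> k) \<in> A" if "k \<in> I" for k
    using that permutes_in_image[OF assms(1)] by (blast intro: PiE_mem[OF assms(2)])
  then show ?thesis
    unfolding permute_profile_def restrict_PiE_iff by blast
qed

text \<open>
  The permutation restricts to a bijection from the opponents of \<open>j\<close> to those of \<open>\<sigma> j\<close>, and each
  opponent of \<open>j\<close> takes over the action of its image.
\<close>

lemma count_vector_delete_permute_profile:
  assumes "\<sigma> permutes I"
  shows "count_vector A (I - {j}) (delete_coord I j (permute_profile I a \<sigma>)) =
    count_vector A (I - {\<sigma> j}) (delete_coord I (\<sigma> j) a)"
proof -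
  have "coord_count (I - {j}) c (permute_profile I a \<sigma>) = coord_count (I - {\<sigma> j}) c a" for c
  proof -
    let ?K = "{k \<in> I - {j}. permute_profile I a \<sigma> k = c}"
    have image: "\<sigma> ` ?K = {k \<in> I - {\<sigma> j}. a k = c}"
    proof (intro set_eqI iffI)
      fix k assume "k \<in> \<sigma> ` ?K"
      then show "k \<in> {k \<in> I - {\<sigma> j}. a k = c}"
        by (auto simp: permute_profile_def permutes_in_image[OF assms]
            inj_eq[OF permutes_inj[OF assms]])
    next
      fix k assume k: "k \<in> {k \<in> I - {\<sigma> j}. a k = c}"
      then have "k \<in> \<sigma> ` I"
        by (simp add: permutes_image[OF assms])
      then obtain l where "l \<in> I" "k = \<sigma> l"
        by blast
      with k show "k \<in> \<sigma> ` ?K"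
        by (auto simp: permute_profile_def)
    qed
    have "inj_on \<sigma> ?K"
      using permutes_inj[OF assms] by (rule inj_on_subset) simp
    from card_image[OF this] show ?thesis
      unfolding coord_count_def image by (rule sym)
  qed
  then show ?thesis
    unfolding count_vector_def coord_count_delete_coord by simp
qed

text \<open>
  The counts determine the multiset of entries of a vector, and vectors with the same multiset of
  entries are rearrangements of each other.  Counts are known only for actions in \<open>A\<close>; this is
  enough because no other value is an entry.
\<close>

lemma permutation_of_equal_counts:
  fixes J :: "'b set" and A :: "'a set"
  assumes "finite J" and x: "x \<in> J \<rightarrow> A" and y: "y \<in> J \<rightarrow> A"
    and counts: "count_vector A J x = count_vector A J y"
  obtains \<sigma> where "\<sigma> permutes J" "\<forall>k\<in>J. y k = x (\<sigma> k)"
proof -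
  have "card {k \<in> J. y k = c} = card {k \<in> J. x k = c}" for c
  proof (cases "c \<in> A")
    case True
    then show ?thesis
      using fun_cong[OF counts, of c] by (simp add: count_vector_def coord_count_def)
  next
    case False
    then have "{k \<in> J. y k = c} = {}" "{k \<in> J. x k = c} = {}"
      using x y by auto
    then show ?thesis by (simp only:)
  qed
  moreover have "count (image_mset f (mset_set J)) c = card {k \<in> J. f k = c}"
    for f :: "'b \<Rightarrow> 'a" and c
  proof -
    have "{k. k \<in># mset_set J \<and> c = f k} = {k \<in> J. f k = c}"
      using \<open>finite J\<close> by auto
    then show ?thesis
      unfolding count_image_mset' using \<open>finite J\<close> by simp
  qed
  ultimately have "image_mset y (mset_set J) = image_mset x (mset_set J)"
    by (intro multiset_eqI) simp
  then obtain \<sigma> where "\<sigma> permutes J" "\<forall>k\<in>J. y k = x (\<sigma> k)"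
    using image_mset_eq_implies_permutes[OF \<open>finite J\<close>] by blast
  then show ?thesis by (rule that)
qed

lemma symmetric_game_imp_blindly_related:
  assumes "symmetric_game I A \<pi>" and "i \<in> I" and "j \<in> I"
  shows "blindly_related I A \<pi> i j"
  unfolding blindly_related_def
proof (intro allI impI ballI)
  fix \<sigma> a
  assume \<sigma>: "\<sigma> permutes I \<and> \<sigma> i = j \<and> \<sigma> j = i" and a: "a \<in> I \<rightarrow>\<^sub>E A"
  let ?b = "permute_profile I a \<sigma>"
  have "?b \<in> I \<rightarrow>\<^sub>E A"
    using permute_profile_in_profiles[OF conjunct1[OF \<sigma>] a] .
  moreover have "a i = ?b j"
    using \<sigma> \<open>j \<in> I\<close> by (simp add: permute_profile_def)
  moreover have "count_vector A (I - {i}) (delete_coord I i a) =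
      count_vector A (I - {j}) (delete_coord I j ?b)"
    using count_vector_delete_permute_profile[of \<sigma> I A j a] \<sigma> by simp
  ultimately show "\<pi> i a = \<pi> j ?b"
    using assms a unfolding symmetric_game_def by blast
qed

text \<open>
  A player blindly related to itself cannot distinguish its opponents, so its payoff depends only
  on the own action and the counts: the special case of symmetry in which both players coincide.
\<close>

lemma blindly_related_self_payoff_eq:
  assumes "finite I" and "j \<in> I" and "blindly_related I A \<pi> j j"
    and c: "c \<in> I \<rightarrow>\<^sub>E A" and b: "b \<in> I \<rightarrow>\<^sub>E A" and "c j = b j"
    and counts: "count_vector A (I - {j}) (delete_coord I j c) =
      count_vector A (I - {j}) (delete_coord I j b)"
  shows "\<pi> j c = \<pi> j b"
proof -
  have "delete_coord I j c \<in> I - {j} \<rightarrow> A" "delete_coord I j b \<in> I - {j} \<rightarrow> A"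
    using c b by (auto simp: delete_coord_def)
  then obtain \<sigma> where \<sigma>: "\<sigma> permutes I - {j}"
    and eq: "\<forall>k\<in>I - {j}. delete_coord I j b k = delete_coord I j c (\<sigma> k)"
    using permutation_of_equal_counts[OF _ _ _ counts] \<open>finite I\<close> by blast
  have "\<sigma> permutes I"
    using \<sigma> by (rule permutes_subset) blast
  have "\<sigma> j = j"
    using \<sigma> by (rule permutes_not_in) simp
  have "permute_profile I c \<sigma> = b"
  proof
    fix k
    consider "k = j" | "k \<in> I - {j}" | "k \<notin> I"
      using \<open>j \<in> I\<close> by blast
    then show "permute_profile I c \<sigma> k = b k"
    proof cases
      case 1
      then show ?thesis
        using \<open>j \<in> I\<close> \<open>\<sigma> j = j\<close> \<open>c j = b j\<close> by (simp add: permute_profile_def)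
    next
      case 2
      then have "\<sigma> k \<in> I - {j}"
        using permutes_in_image[OF \<sigma>] by blast
      then show ?thesis
        using 2 bspec[OF eq 2] by (simp add: permute_profile_def delete_coord_def)
    next
      case 3
      then show ?thesis
        using PiE_arb[OF b 3] by (simp add: permute_profile_def)
    qed
  qed
  moreover have "\<pi> j c = \<pi> j (permute_profile I c \<sigma>)"
    using assms(3) \<open>\<sigma> permutes I\<close> \<open>\<sigma> j = j\<close> c unfolding blindly_related_def by simp
  ultimately show ?thesis by simp
qed

lemma blindly_related_imp_symmetric_game:
  assumes "finite I" and blind: "\<forall>i\<in>I. \<forall>j\<in>I. blindly_related I A \<pi> i j"
  shows "symmetric_game I A \<pi>"
  unfolding symmetric_game_def
proof (intro ballI impI, elim conjE)
  fix i j a b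
  assume i: "i \<in> I" and j: "j \<in> I" and a: "a \<in> I \<rightarrow>\<^sub>E A" and b: "b \<in> I \<rightarrow>\<^sub>E A"
    and "a i = b j"
    and counts: "count_vector A (I - {i}) (delete_coord I i a) =
      count_vector A (I - {j}) (delete_coord I j b)"
  let ?\<tau> = "transpose i j"
  let ?c = "permute_profile I a ?\<tau>"
  have \<tau>: "?\<tau> permutes I"
    using i j by (rule permutes_swap_id)
  have c: "?c \<in> I \<rightarrow>\<^sub>E A"
    using \<tau> a by (rule permute_profile_in_profiles)
  have "\<pi> i a = \<pi> j ?c"
    using blind i j \<tau> a unfolding blindly_related_def by simp
  also have "\<dots> = \<pi> j b"
  proof (rule blindly_related_self_payoff_eq[OF \<open>finite I\<close> j _ c b])
    show "blindly_related I A \<pi> j j"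
      using blind j by blast
    show "?c j = b j"
      using j \<open>a i = b j\<close> by (simp add: permute_profile_def)
    show "count_vector A (I - {j}) (delete_coord I j ?c) =
        count_vector A (I - {j}) (delete_coord I j b)"
      using count_vector_delete_permute_profile[OF \<tau>, of A j a] counts by simp
  qed
  finally show "\<pi> i a = \<pi> j b" .
qed

theorem lemma5p5:
  fixes n :: nat
    and A :: "'a set"
    and \<pi> :: "nat \<Rightarrow> (nat \<Rightarrow> 'a) \<Rightarrow> real"
  assumes "finite A"
  shows "symmetric_game {1..n} A \<pi> \<longleftrightarrow>
    (\<forall>i\<in>{1..n}. \<forall>j\<in>{1..n}. blindly_related {1..n} A \<pi> i j)"
  using symmetric_game_imp_blindly_related[of "{1..n}" A \<pi>]
    blindly_related_imp_symmetric_game[of "{1..n}" A \<pi>]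
  by blast

end
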